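(* For $n\geq5$, the third distance ideal of the directed circuit $\overrightarrow{C_n}$ is $I_3(\overrightarrow{C_n})=\langle x_1,x_2,\dots,x_n,n\rangle\subseteq\mathbb{Z}[x_1,\dots,x_n]$.
   Context: $\overrightarrow{C_n}$ has vertices $v_1,\dots,v_n$ and arcs $(v_i,v_{i+1})$ for $1\leq i<n$ and $(v_n,v_1)$; its distance matrix $D$ has $(i,j)$-entry $(j-i)\bmod n\in\{0,\dots,n-1\}$. With indeterminate $x_i$ attached to $v_i$, $D_X(\overrightarrow{C_n})=\operatorname{diag}(x_1,\dots,x_n)+D$, and $I_3(\overrightarrow{C_n})$ is the ideal of $\mathbb{Z}[x_1,\dots,x_n]$ generated by all $3\times3$ minors of $D_X(\overrightarrow{C_n})$. *)

theory Defs
  imports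
    "HOL-Library.Poly_Mapping"
    "HOL-Algebra.Ideal"
    "Jordan_Normal_Form.Determinant"
    "Jordan_Normal_Form.DL_Submatrix"
    "Graph_Theory.Pair_Digraph"
begin

section \<open>The polynomial ring in \<open>x\<^sub>1, \<dots>, x\<^sub>n\<close> over the integers\<close>

text \<open>Monomials are finitely supported exponent vectors; the type itself has one indeterminate for
  every natural number, and the ring in \<open>x\<^sub>1, \<dots>, x\<^sub>n\<close> is carved out as a carrier.\<close>

type_synonym int_mpoly = "(nat \<Rightarrow>\<^sub>0 nat) \<Rightarrow>\<^sub>0 int"

definition indet :: "nat \<Rightarrow> int_mpoly" where
  "indet i = Poly_Mapping.single (Poly_Mapping.single i 1) 1"

definition int_mpoly_ring :: "nat \<Rightarrow> int_mpoly ring" where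
  "int_mpoly_ring n =
    \<lparr> carrier = {p. \<forall>m \<in> Poly_Mapping.keys p. Poly_Mapping.keys m \<subseteq> {1..n}},
      monoid.mult = (*), one = 1, zero = 0, add = (+) \<rparr>"

section \<open>Distance ideals of digraphs with vertex set \<open>{1, \<dots>, n}\<close>\<close>

text \<open>The number of arcs of a shortest directed path; the value is only meaningful when \<open>v\<close> is
  reachable from \<open>u\<close>.\<close>

definition digraph_dist :: "nat pair_pre_digraph \<Rightarrow> nat \<Rightarrow> nat \<Rightarrow> nat" where
  "digraph_dist G u v = (LEAST k. \<exists>p. pre_digraph.apath (with_proj G) u p v \<and> length p = k)"

text \<open>Matrix indices start at 0, so row and column \<open>i\<close> belong to vertex \<open>i + 1\<close>.\<close>

definition distance_matrix :: "nat \<Rightarrow> nat pair_pre_digraph \<Rightarrow> int mat" where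
  "distance_matrix n G = mat n n (\<lambda>(i, j). int (digraph_dist G (Suc i) (Suc j)))"

definition generalized_distance_matrix :: "nat \<Rightarrow> nat pair_pre_digraph \<Rightarrow> int_mpoly mat" where
  "generalized_distance_matrix n G =
    mat_diag n (\<lambda>i. indet (Suc i)) + map_mat of_int (distance_matrix n G)"

definition minors :: "nat \<Rightarrow> 'a :: comm_ring_1 mat \<Rightarrow> 'a set" where
  "minors k A = {det (submatrix A I J) | I J.
     I \<subseteq> {..<dim_row A} \<and> J \<subseteq> {..<dim_col A} \<and> card I = k \<and> card J = k}"

definition distance_ideal :: "nat \<Rightarrow> nat \<Rightarrow> nat pair_pre_digraph \<Rightarrow> int_mpoly set" where
  "distance_ideal k n G =
    Idl\<^bsub>int_mpoly_ring n\<^esub> (minors k (generalized_distance_matrix n G))"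

definition directed_circuit :: "nat \<Rightarrow> nat pair_pre_digraph" where
  "directed_circuit n =
    \<lparr> pverts = {1..n}, parcs = {(i, Suc i) | i. 1 \<le> i \<and> i < n} \<union> {(n, 1)} \<rparr>"

section \<open>Basic properties\<close>

lemma int_mpoly_ring_simps [simp]:
  "monoid.mult (int_mpoly_ring n) = (*)" "one (int_mpoly_ring n) = 1"
  "zero (int_mpoly_ring n) = 0" "add (int_mpoly_ring n) = (+)"
  by (simp_all add: int_mpoly_ring_def)

lemma int_mpoly_ring_carrier:
  "p \<in> carrier (int_mpoly_ring n) \<longleftrightarrow>
     (\<forall>m \<in> Poly_Mapping.keys p. Poly_Mapping.keys m \<subseteq> {1..n})"
  by (simp add: int_mpoly_ring_def)

lemma int_mpoly_ring_closed:
  shows int_mpoly_ring_zero: "0 \<in> carrier (int_mpoly_ring n)"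
    and int_mpoly_ring_one: "1 \<in> carrier (int_mpoly_ring n)"
    and int_mpoly_ring_uminus:
      "p \<in> carrier (int_mpoly_ring n) \<Longrightarrow> - p \<in> carrier (int_mpoly_ring n)"
    and int_mpoly_ring_add:
      "p \<in> carrier (int_mpoly_ring n) \<Longrightarrow> q \<in> carrier (int_mpoly_ring n) \<Longrightarrow>
       p + q \<in> carrier (int_mpoly_ring n)"
    and int_mpoly_ring_mult:
      "p \<in> carrier (int_mpoly_ring n) \<Longrightarrow> q \<in> carrier (int_mpoly_ring n) \<Longrightarrow>
       p * q \<in> carrier (int_mpoly_ring n)"
proof -
  show "p + q \<in> carrier (int_mpoly_ring n)"
    if "p \<in> carrier (int_mpoly_ring n)" "q \<in> carrier (int_mpoly_ring n)"
    using that Poly_Mapping.keys_add[of p q] unfolding int_mpoly_ring_carrier by blast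
  show "p * q \<in> carrier (int_mpoly_ring n)"
    if pq: "p \<in> carrier (int_mpoly_ring n)" "q \<in> carrier (int_mpoly_ring n)"
    unfolding int_mpoly_ring_carrier
  proof
    fix m assume "m \<in> Poly_Mapping.keys (p * q)"
    then obtain a b where "m = a + b" "a \<in> Poly_Mapping.keys p" "b \<in> Poly_Mapping.keys q"
      using keys_mult[of p q] by blast
    then show "Poly_Mapping.keys m \<subseteq> {1..n}"
      using pq Poly_Mapping.keys_add[of a b] unfolding int_mpoly_ring_carrier by blast
  qed
qed (simp_all add: int_mpoly_ring_carrier)

lemma int_mpoly_ring_cring: "cring (int_mpoly_ring n)"
proof (rule cringI)
  show "abelian_group (int_mpoly_ring n)"
  proof (rule abelian_groupI)
    fix x assume "x \<in> carrier (int_mpoly_ring n)"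
    then show "\<exists>y\<in>carrier (int_mpoly_ring n). y \<oplus>\<^bsub>int_mpoly_ring n\<^esub> x = \<zero>\<^bsub>int_mpoly_ring n\<^esub>"
      by (intro bexI[of _ "- x"]) (simp_all add: int_mpoly_ring_uminus)
  qed (simp_all add: int_mpoly_ring_zero int_mpoly_ring_add algebra_simps)
  show "Group.comm_monoid (int_mpoly_ring n)"
    by (rule comm_monoidI)
      (simp_all add: int_mpoly_ring_one int_mpoly_ring_mult algebra_simps)
qed (simp_all add: algebra_simps)

lemma int_mpoly_ring_sum:
  "(\<And>a. a \<in> A \<Longrightarrow> f a \<in> carrier (int_mpoly_ring n)) \<Longrightarrow>
    sum f A \<in> carrier (int_mpoly_ring n)"
  by (induction A rule: infinite_finite_induct)
    (simp_all add: int_mpoly_ring_zero int_mpoly_ring_add)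

lemma int_mpoly_ring_prod:
  "(\<And>a. a \<in> A \<Longrightarrow> f a \<in> carrier (int_mpoly_ring n)) \<Longrightarrow>
    prod f A \<in> carrier (int_mpoly_ring n)"
  by (induction A rule: infinite_finite_induct)
    (simp_all add: int_mpoly_ring_one int_mpoly_ring_mult)

lemma int_mpoly_ring_of_nat: "of_nat k \<in> carrier (int_mpoly_ring n)"
  by (induction k) (simp_all add: int_mpoly_ring_zero int_mpoly_ring_one int_mpoly_ring_add)

lemma int_mpoly_ring_of_int: "of_int k \<in> carrier (int_mpoly_ring n)"
  by (cases k) (simp_all only: of_int_of_nat_eq of_int_minus int_mpoly_ring_of_nat
      int_mpoly_ring_uminus)

lemma int_mpoly_ring_indet: "i \<in> {1..n} \<Longrightarrow> indet i \<in> carrier (int_mpoly_ring n)"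
  by (simp add: indet_def int_mpoly_ring_carrier)

lemma minors_generalized_distance_matrix_carrier:
  "minors k (generalized_distance_matrix n G) \<subseteq> carrier (int_mpoly_ring n)"
proof
  fix d assume "d \<in> minors k (generalized_distance_matrix n G)"
  then obtain I J where d: "d = det (submatrix (generalized_distance_matrix n G) I J)"
    and I: "I \<subseteq> {..<n}" "card I = k" and J: "J \<subseteq> {..<n}" "card J = k"
    by (auto simp: minors_def generalized_distance_matrix_def distance_matrix_def)
  let ?A = "generalized_distance_matrix n G"
  let ?B = "submatrix ?A I J"
  have dimA: "dim_row ?A = n" "dim_col ?A = n"
    by (auto simp: generalized_distance_matrix_def distance_matrix_def)
  have IJ: "{i. i < n \<and> i \<in> I} = I" "{j. j < n \<and> j \<in> J} = J" using I J by auto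
  have B: "?B \<in> carrier_mat k k"
    using I J by (intro carrier_matI) (simp_all add: dim_submatrix dimA IJ)
  have ent: "?B $$ (i, j) \<in> carrier (int_mpoly_ring n)" if "i < k" "j < k" for i j
  proof -
    have "pick I i < n" "pick J j < n"
      using that I J pick_in_set_le[of i I] pick_in_set_le[of j J] by auto
    moreover have "?B $$ (i, j) = ?A $$ (pick I i, pick J j)"
      using that I J by (simp add: submatrix_def dimA IJ)
    ultimately show ?thesis
      by (auto simp: generalized_distance_matrix_def distance_matrix_def mat_diag_def
          intro!: int_mpoly_ring_add int_mpoly_ring_of_nat int_mpoly_ring_indet)
  qed
  have "det ?B = (\<Sum>p \<in> {p. p permutes {0..<k}}. signof p * (\<Prod>i = 0..<k. ?B $$ (i, p i)))"
    using B by (rule det_def')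
  also have "\<dots> \<in> carrier (int_mpoly_ring n)"
  proof (intro int_mpoly_ring_sum int_mpoly_ring_mult int_mpoly_ring_prod)
    fix p assume p: "p \<in> {p. p permutes {0..<k}}"
    show "signof p \<in> carrier (int_mpoly_ring n)"
      by (auto simp: sign_def int_mpoly_ring_one int_mpoly_ring_uminus)
    fix i assume "i \<in> {0..<k}"
    then show "?B $$ (i, p i) \<in> carrier (int_mpoly_ring n)"
      using p permutes_in_image[of p "{0..<k}" i] by (intro ent) auto
  qed
  finally show "d \<in> carrier (int_mpoly_ring n)" using d by simp
qed

lemma directed_circuit_walk_length:
  assumes "pcas u p v" "set p \<subseteq> parcs (directed_circuit n)"
  shows "(int v - int u) mod int n = int (length p) mod int n"
  using assms
proof (induction p arbitrary: u)
  case (Cons e p)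
  obtain w where e: "e = (u, w)" and w: "pcas w p v" using Cons.prems by (cases e) auto
  have "(int w - int u) mod int n = 1 mod int n"
    using Cons.prems e
    by (auto simp: directed_circuit_def mod_eq_dvd_iff)
  moreover have "(int v - int w) mod int n = int (length p) mod int n"
    using Cons w by auto
  ultimately have "((int w - int u) + (int v - int w)) mod int n
      = (1 + int (length p)) mod int n"
    by (rule mod_add_cong)
  then show ?case by simp
qed auto

lemma directed_circuit_walk_exists:
  assumes "n \<ge> 1" "i < n"
  shows "\<exists>p. pcas (Suc i) p (Suc ((i + k) mod n)) \<and> set p \<subseteq> parcs (directed_circuit n)
     \<and> length p = k \<and> pawalk_verts (Suc i) p = map (\<lambda>l. Suc ((i + l) mod n)) [0..<Suc k]"
  using assms(2)
proof (induction k arbitrary: i)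
  case 0
  then show ?case by (intro exI[of _ "[]"]) auto
next
  case (Suc k)
  let ?j = "Suc i mod n"
  have "?j < n" using assms by simp
  from Suc.IH[OF this] obtain p where p: "pcas (Suc ?j) p (Suc ((?j + k) mod n))"
    "set p \<subseteq> parcs (directed_circuit n)" "length p = k"
    "pawalk_verts (Suc ?j) p = map (\<lambda>l. Suc ((?j + l) mod n)) [0..<Suc k]" by blast
  have arc: "(Suc i, Suc ?j) \<in> parcs (directed_circuit n)"
    using Suc.prems by (cases "Suc i = n") (auto simp: directed_circuit_def)
  have m: "(?j + l) mod n = (i + Suc l) mod n" for l by (simp add: mod_simps)
  have "[0..<Suc (Suc k)] = 0 # map Suc [0..<Suc k]"
    by (simp only: map_Suc_upt upt_conv_Cons[of 0 "Suc (Suc k)"] zero_less_Suc)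
  then have "pawalk_verts (Suc i) ((Suc i, Suc ?j) # p)
      = map (\<lambda>l. Suc ((i + l) mod n)) [0..<Suc (Suc k)]"
    using p(4) Suc.prems by (simp only: m) (simp add: comp_def)
  then show ?case using p arc m[of k]
    by (intro exI[of _ "(Suc i, Suc ?j) # p"]) auto
qed

lemma digraph_dist_directed_circuit:
  assumes "i < n" "j < n"
  shows "int (digraph_dist (directed_circuit n) (Suc i) (Suc j)) = (int j - int i) mod int n"
proof -
  interpret pair_pre_digraph "directed_circuit n" .
  define k where "k = nat ((int j - int i) mod int n)"
  have k: "int k = (int j - int i) mod int n" "k < n"
    using assms by (auto simp: k_def nat_less_iff)
  have "int ((i + k) mod n) = int j"
    using assms by (simp add: zmod_int k(1) mod_simps)
  then have j: "(i + k) mod n = j" by linarith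
  have "n \<ge> 1" using assms by simp
  from directed_circuit_walk_exists[OF this assms(1), of k] j obtain p
    where p: "pcas (Suc i) p (Suc j)" "set p \<subseteq> parcs (directed_circuit n)" "length p = k"
      "pawalk_verts (Suc i) p = map (\<lambda>l. Suc ((i + l) mod n)) [0..<Suc k]" by auto
  have "inj_on (\<lambda>l. Suc ((i + l) mod n)) {0..<Suc k}"
  proof (rule inj_onI)
    fix a b assume ab: "a \<in> {0..<Suc k}" "b \<in> {0..<Suc k}"
      "Suc ((i + a) mod n) = Suc ((i + b) mod n)"
    then have "int (i + a) mod int n = int (i + b) mod int n" by (simp only: Suc_inject flip: zmod_int)
    then have "int n dvd int a - int b" by (simp add: mod_eq_dvd_iff)
    moreover have "\<bar>int a - int b\<bar> < int n" using ab(1,2) k(2) by auto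
    ultimately show "a = b" using dvd_imp_le_int[of "int a - int b" "int n"] by linarith
  qed
  then have "apath (Suc i) p (Suc j)"
    unfolding apath_def awalk_def using p assms
    by (simp add: distinct_map directed_circuit_def del: upt_Suc)
  moreover have "k \<le> length q" if "apath (Suc i) q (Suc j)" for q
  proof -
    have "int k = int (length q) mod int n"
      using directed_circuit_walk_length[of "Suc i" q "Suc j" n] that k(1)
      unfolding apath_def awalk_def by simp
    then show ?thesis by (metis mod_less_eq_dividend of_nat_eq_iff zmod_int)
  qed
  ultimately have "digraph_dist (directed_circuit n) (Suc i) (Suc j) = k"
    unfolding digraph_dist_def using p(3) by (intro Least_equality) auto
  then show ?thesis using k by simp
qed

lemma distance_matrix_directed_circuit:
  "distance_matrix n (directed_circuit n) = mat n n (\<lambda>(i, j). (int j - int i) mod int n)"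
  by (rule eq_matI) (simp_all add: distance_matrix_def digraph_dist_directed_circuit)

end

theory Submission
  imports Defs
begin

text \<open>Modulo \<open>\<langle>x\<^sub>1, \<dots>, x\<^sub>n, n\<rangle>\<close> the \<open>(i, j)\<close>-entry of the matrix is \<open>j - i\<close>, a matrix of rank at most
  two, so every \<open>3 \<times> 3\<close> minor lies in that ideal. Conversely, the minor on the cyclically consecutive
  rows \<open>k - 2, k - 1, k\<close> and columns \<open>k, k + 1, k + 2\<close> is
  \<open>det [[2, 3, 4], [1, 2, 3], [x, 1, 2]] = x\<close> with \<open>x\<close> the diagonal entry at \<open>k\<close>, and the minor
  on the rows \<open>0, 1, 3\<close> and columns \<open>2, 3, 4\<close> is
  \<open>det [[2, 3, 4], [1, 2, 3], [n - 1, x, 1]] = n - 2 x\<close> with \<open>x\<close> the diagonal entry at \<open>3\<close>.\<close>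

section \<open>Minors of order three as explicit expressions in the entries\<close>

text \<open>Laplace expansion along the first listed row. The indices may come in any order, whereas
  \<open>submatrix\<close> always arranges them increasingly; this admits index triples that wrap
  around.\<close>

definition minor3 ::
    "'a :: comm_ring_1 mat \<Rightarrow> nat \<Rightarrow> nat \<Rightarrow> nat \<Rightarrow> nat \<Rightarrow> nat \<Rightarrow> nat \<Rightarrow> 'a" where
  "minor3 A a b c d e f =
      A $$ (a, d) * (A $$ (b, e) * A $$ (c, f) - A $$ (b, f) * A $$ (c, e))
    - A $$ (a, e) * (A $$ (b, d) * A $$ (c, f) - A $$ (b, f) * A $$ (c, d))
    + A $$ (a, f) * (A $$ (b, d) * A $$ (c, e) - A $$ (b, e) * A $$ (c, d))"

lemma minor3_rotate_rows: "minor3 A b c a d e f = minor3 A a b c d e f"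
  by (simp add: minor3_def algebra_simps)

lemma minor3_rotate_cols: "minor3 A a b c e f d = minor3 A a b c d e f"
  by (simp add: minor3_def algebra_simps)

lemma det_2_2:
  fixes A :: "'a :: comm_ring_1 mat"
  assumes "A \<in> carrier_mat 2 2"
  shows "det A = A $$ (0, 0) * A $$ (1, 1) - A $$ (0, 1) * A $$ (1, 0)"
proof -
  have "det (mat_delete A 0 j) = mat_delete A 0 j $$ (0, 0)" for j
    using mat_delete_carrier[OF assms, of 0 j] by (intro det_single) simp
  then show ?thesis
    using assms
    by (simp add: laplace_expansion_row[OF assms, of 0] cofactor_def mat_delete_def
        numeral_2_eq_2)
qed

lemma det_3_3:
  fixes A :: "'a :: comm_ring_1 mat"
  assumes A: "A \<in> carrier_mat 3 3"
  shows "det A = minor3 A 0 1 2 0 1 2"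
proof -
  have "det (mat_delete A 0 j) =
      mat_delete A 0 j $$ (0, 0) * mat_delete A 0 j $$ (1, 1)
      - mat_delete A 0 j $$ (0, 1) * mat_delete A 0 j $$ (1, 0)" for j
    using mat_delete_carrier[OF A, of 0 j] by (intro det_2_2) simp
  then show ?thesis
    using A
    by (simp add: laplace_expansion_row[OF A, of 0] cofactor_def minor3_def mat_delete_def
        numeral_3_eq_3 numeral_2_eq_2) (simp add: algebra_simps)
qed

lemma det_submatrix_3:
  fixes A :: "'a :: comm_ring_1 mat"
  assumes "I \<subseteq> {..<dim_row A}" "J \<subseteq> {..<dim_col A}" "card I = 3" "card J = 3"
  shows "det (submatrix A I J)
    = minor3 A (pick I 0) (pick I 1) (pick I 2) (pick J 0) (pick J 1) (pick J 2)"
proof -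
  have IJ: "{i. i < dim_row A \<and> i \<in> I} = I" "{j. j < dim_col A \<and> j \<in> J} = J"
    using assms by auto
  have "submatrix A I J \<in> carrier_mat 3 3"
    using assms by (intro carrier_matI) (simp_all add: dim_submatrix IJ)
  from det_3_3[OF this] show ?thesis
    using assms by (simp add: minor3_def submatrix_index IJ del: pick.simps)
qed

text \<open>An element of a set is picked at the position that counts the smaller elements of the
  set; here the counts are 0, 1 and 2.\<close>

lemma pick_3:
  assumes "a < b" "b < c"
  shows "pick {a, b, c} 0 = a" "pick {a, b, c} 1 = b" "pick {a, b, c} 2 = c"
proof -
  have "{y \<in> {a, b, c}. y < a} = {}" "{y \<in> {a, b, c}. y < b} = {a}"
    "{y \<in> {a, b, c}. y < c} = {a, b}"
    using assms by auto
  then have card: "card {y \<in> {a, b, c}. y < a} = 0" "card {y \<in> {a, b, c}. y < b} = 1"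
    "card {y \<in> {a, b, c}. y < c} = 2"
    using assms by simp_all
  show "pick {a, b, c} 0 = a" "pick {a, b, c} 1 = b" "pick {a, b, c} 2 = c"
    using pick_card_in_set[of a "{a, b, c}"] pick_card_in_set[of b "{a, b, c}"]
      pick_card_in_set[of c "{a, b, c}"] unfolding card by blast+
qed

lemma minor3_in_minors_sorted:
  assumes "a < b" "b < c" "c < dim_row A" "d < e" "e < f" "f < dim_col A"
  shows "minor3 A a b c d e f \<in> minors 3 A"
proof -
  have "det (submatrix A {a, b, c} {d, e, f}) = minor3 A a b c d e f"
    using assms by (subst det_submatrix_3) (auto simp only: pick_3, auto)
  then show ?thesis
    unfolding minors_def using assms
    by (intro CollectI exI[of _ "{a, b, c}"] exI[of _ "{d, e, f}"]) auto
qed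

text \<open>Cyclically consecutive indices that pass \<open>n - 1\<close> form a rotation of an
  increasing triple; the disjuncts are the three rotations.\<close>

definition cyclically_sorted :: "nat \<Rightarrow> nat \<Rightarrow> nat \<Rightarrow> bool" where
  "cyclically_sorted a b c \<longleftrightarrow> a < b \<and> b < c \<or> b < c \<and> c < a \<or> c < a \<and> a < b"

text \<open>A rotation of three rows or columns is an even permutation, so it does not change the sign.\<close>

lemma minor3_in_minors:
  assumes "cyclically_sorted a b c" "cyclically_sorted d e f"
    and "a < dim_row A" "b < dim_row A" "c < dim_row A"
    and "d < dim_col A" "e < dim_col A" "f < dim_col A"
  shows "minor3 A a b c d e f \<in> minors 3 A"
proof -
  \<comment> \<open>The columns are rotated into increasing order first, under increasing rows; the
    rows follow.\<close>
  have sorted_rows: "minor3 A a b c d e f \<in> minors 3 A"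
    if "a < b" "b < c" "c < dim_row A" for a b c
    using assms(2,6-8) that
      minor3_in_minors_sorted[of a b c A d e f] minor3_in_minors_sorted[of a b c A e f d]
      minor3_in_minors_sorted[of a b c A f d e]
    unfolding cyclically_sorted_def
    by (auto simp: minor3_rotate_cols[of A a b c d e f] minor3_rotate_cols[of A a b c e f d]
        simp flip: minor3_rotate_cols[of A a b c f d e])
  show ?thesis
    using assms(1,3-5) sorted_rows[of a b c] sorted_rows[of b c a] sorted_rows[of c a b]
      minor3_rotate_rows[of A a b c d e f] minor3_rotate_rows[of A c a b d e f]
    unfolding cyclically_sorted_def by auto
qed

text \<open>Just the bounds on the indices are kept, because the congruence argument works for
  arbitrary rows and columns.\<close>

lemma minors_3E:
  assumes "p \<in> minors 3 A"
  obtains a b c d e f where "p = minor3 A a b c d e f"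
    "a < dim_row A" "b < dim_row A" "c < dim_row A"
    "d < dim_col A" "e < dim_col A" "f < dim_col A"
proof -
  from assms obtain I J where IJ: "p = det (submatrix A I J)" "I \<subseteq> {..<dim_row A}"
    "J \<subseteq> {..<dim_col A}" "card I = 3" "card J = 3"
    unfolding minors_def by blast
  have "pick I i \<in> I" "pick J i \<in> J" if "i < 3" for i
    using that IJ by (simp_all add: pick_in_set_le)
  then have "pick I i < dim_row A" "pick J i < dim_col A" if "i < 3" for i
    using that IJ by blast+
  with IJ show ?thesis
    by (intro that[OF trans[OF IJ(1) det_submatrix_3]]) (simp_all del: pick.simps)
qed

section \<open>Entries of the generalized distance matrix of the circuit\<close>

lemma dim_generalized_distance_matrix [simp]:
  "dim_row (generalized_distance_matrix n G) = n" "dim_col (generalized_distance_matrix n G) = n"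
  by (simp_all add: generalized_distance_matrix_def distance_matrix_def)

abbreviation circuit_matrix :: "nat \<Rightarrow> int_mpoly mat" where
  "circuit_matrix n \<equiv> generalized_distance_matrix n (directed_circuit n)"

lemma circuit_matrix_index:
  assumes "i < n" "j < n"
  shows "circuit_matrix n $$ (i, j)
    = (if i = j then indet (Suc i) else 0) + of_int ((int j - int i) mod int n)"
  using assms
  by (simp add: generalized_distance_matrix_def distance_matrix_directed_circuit mat_diag_def)

lemma circuit_matrix_diag: "i < n \<Longrightarrow> circuit_matrix n $$ (i, i) = indet (Suc i)"
  by (simp add: circuit_matrix_index)

text \<open>The second disjunct covers paths that wrap past index \<open>n - 1\<close>: there
  \<open>j - i = d - n\<close>, which has residue \<open>d\<close>. The bounds on \<open>d\<close>
  keep the entry off the diagonal.\<close>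

lemma circuit_matrix_offset:
  assumes "i < n" "j < n" "0 < d" "d < n" "j = i + d \<or> j + n = i + d"
  shows "circuit_matrix n $$ (i, j) = of_nat d"
proof -
  have "(int j - int i) mod int n = int d"
  proof (cases "j = i + d")
    case False
    then have "int j - int i = int d - int n" using assms by linarith
    then show ?thesis using assms by simp
  qed (use assms in simp)
  then show ?thesis using assms by (auto simp: circuit_matrix_index)
qed

section \<open>Congruence modulo an ideal, expressed as membership of the difference\<close>

lemma ideal_int_mpoly_ring_add:
  assumes "ideal K (int_mpoly_ring n)" "p \<in> K" "q \<in> K"
  shows "p + q \<in> K"
  using additive_subgroup.a_closed[OF ideal.axioms(1)[OF assms(1)] assms(2,3)] by simp

lemma ideal_int_mpoly_ring_mult:
  assumes "ideal K (int_mpoly_ring n)" "p \<in> K" "q \<in> carrier (int_mpoly_ring n)"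
  shows "p * q \<in> K" "q * p \<in> K"
  using ideal.I_l_closed[OF assms] ideal.I_r_closed[OF assms] by simp_all

lemma ideal_int_mpoly_ring_diff:
  assumes "ideal K (int_mpoly_ring n)" "p \<in> K" "q \<in> K"
  shows "p - q \<in> K"
proof -
  have "q * (- 1) \<in> K"
    using assms by (intro ideal_int_mpoly_ring_mult int_mpoly_ring_uminus int_mpoly_ring_one)
  from ideal_int_mpoly_ring_add[OF assms(1,2) this] show ?thesis by simp
qed

text \<open>The difference equals \<open>(p - p') * q + p' * (q - q')\<close>, where elements of
  \<open>K\<close> are multiplied by \<open>q\<close> and \<open>p'\<close>; hence the two carrier
  hypotheses.\<close>

lemma ideal_cong_mult:
  assumes K: "ideal K (int_mpoly_ring n)"
    and "p - p' \<in> K" "q - q' \<in> K" "q \<in> carrier (int_mpoly_ring n)" "p' \<in> carrier (int_mpoly_ring n)"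
  shows "p * q - p' * q' \<in> K"
proof -
  have "(p - p') * q + p' * (q - q') \<in> K"
    using assms by (intro ideal_int_mpoly_ring_add[OF K] ideal_int_mpoly_ring_mult[OF K])
  then show ?thesis by (simp add: algebra_simps)
qed

lemma ideal_cong_add:
  assumes "ideal K (int_mpoly_ring n)" "p - p' \<in> K" "q - q' \<in> K"
  shows "(p + q) - (p' + q') \<in> K"
  using ideal_int_mpoly_ring_add[OF assms] by (simp add: algebra_simps)

lemma ideal_cong_diff:
  assumes "ideal K (int_mpoly_ring n)" "p - p' \<in> K" "q - q' \<in> K"
  shows "(p - q) - (p' - q') \<in> K"
  using ideal_int_mpoly_ring_diff[OF assms] by (simp add: algebra_simps)

lemma int_mpoly_ring_diff:
  assumes "p \<in> carrier (int_mpoly_ring n)" "q \<in> carrier (int_mpoly_ring n)"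
  shows "p - q \<in> carrier (int_mpoly_ring n)"
  using int_mpoly_ring_add[OF assms(1) int_mpoly_ring_uminus[OF assms(2)]] by simp

lemma minor3_circuit_matrix_in_ideal:
  assumes K: "ideal K (int_mpoly_ring n)" and x: "indet ` {1..n} \<subseteq> K" and n: "of_nat n \<in> K"
    and less: "a < n" "b < n" "c < n" "d < n" "e < n" "f < n"
  shows "minor3 (circuit_matrix n) a b c d e f \<in> K"
proof -
  let ?A = "circuit_matrix n"
  let ?P = "\<lambda>i j. of_int (int j - int i) :: int_mpoly"
  have zero: "0 \<in> K" using ideal_int_mpoly_ring_diff[OF K n n] by simp
  have carrier_P: "?P i j \<in> carrier (int_mpoly_ring n)" for i j by (rule int_mpoly_ring_of_int)
  have cong: "?A $$ (i, j) - ?P i j \<in> K" if "i < n" "j < n" for i j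
  proof -
    \<comment> \<open>\<open>?q\<close> counts the multiples of \<open>n\<close> by which the
      difference exceeds its residue; that multiple of \<open>n\<close> lies in
      \<open>K\<close>.\<close>
    let ?q = "(int j - int i) div int n"
    have "int j - int i = ?q * int n + (int j - int i) mod int n" by simp
    then have "?P i j = of_int ?q * of_nat n + of_int ((int j - int i) mod int n)"
      by (metis of_int_add of_int_mult of_int_of_nat_eq)
    then have "?A $$ (i, j) - ?P i j
        = (if i = j then indet (Suc i) else 0) - of_int ?q * of_nat n"
      using that by (simp add: circuit_matrix_index)
    also have "\<dots> \<in> K"
      using x that zero n
      by (intro ideal_int_mpoly_ring_diff[OF K] ideal_int_mpoly_ring_mult(2)[OF K]
          int_mpoly_ring_of_int) auto
    finally show ?thesis .
  qed
  have carrier_A: "?A $$ (i, j) \<in> carrier (int_mpoly_ring n)" if "i < n" "j < n" for i j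
    using that
    by (auto simp: circuit_matrix_index
        intro!: int_mpoly_ring_add int_mpoly_ring_of_int int_mpoly_ring_indet int_mpoly_ring_zero)
  \<comment> \<open>A minor is a polynomial in the entries, so the entrywise congruences carry over
    to it.\<close>
  have "minor3 ?A a b c d e f -
      (?P a d * (?P b e * ?P c f - ?P b f * ?P c e)
      - ?P a e * (?P b d * ?P c f - ?P b f * ?P c d)
      + ?P a f * (?P b d * ?P c e - ?P b e * ?P c d)) \<in> K"
    unfolding minor3_def
    by (intro ideal_cong_add[OF K] ideal_cong_diff[OF K] ideal_cong_mult[OF K] cong less
        int_mpoly_ring_diff int_mpoly_ring_mult carrier_A carrier_P)
  \<comment> \<open>Each \<open>?P i j\<close> is a column term minus a row term, so the matrix is a
    sum of two rank-one matrices and its minors of order three vanish identically.\<close>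
  moreover have "?P a d * (?P b e * ?P c f - ?P b f * ?P c e)
      - ?P a e * (?P b d * ?P c f - ?P b f * ?P c d)
      + ?P a f * (?P b d * ?P c e - ?P b e * ?P c d) = 0"
    by (simp add: algebra_simps)
  ultimately show ?thesis by simp
qed

section \<open>Minors that yield the generators\<close>

lemma indet_in_minors:
  assumes "n \<ge> 5" "k < n"
  shows "indet (Suc k) \<in> minors 3 (circuit_matrix n)"
proof -
  \<comment> \<open>The indices \<open>k - 2\<close>, \<open>k - 1\<close>, \<open>k + 1\<close>,
    \<open>k + 2\<close> modulo \<open>n\<close>, with the wrap spelled out by cases so that linear
    arithmetic applies.\<close>
  define r0 where "r0 = (if k \<ge> 2 then k - 2 else k + n - 2)"
  define r1 where "r1 = (if k \<ge> 1 then k - 1 else k + n - 1)"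
  define c1 where "c1 = (if k + 1 < n then k + 1 else k + 1 - n)"
  define c2 where "c2 = (if k + 2 < n then k + 2 else k + 2 - n)"
  note defs = r0_def r1_def c1_def c2_def
  have less: "r0 < n" "r1 < n" "c1 < n" "c2 < n" using assms by (auto simp: defs)
  have off: "r0 + 2 = k \<or> r0 + 2 = k + n" "r1 + 1 = k \<or> r1 + 1 = k + n"
      "c1 = k + 1 \<or> c1 + n = k + 1" "c2 = k + 2 \<or> c2 + n = k + 2"
    using assms by (auto simp: defs)
  \<comment> \<open>The largest offset, 4 from \<open>r0\<close> to \<open>c2\<close>, is below
    \<open>n\<close> because \<open>n \<ge> 5\<close>.\<close>
  have "circuit_matrix n $$ (r0, k) = of_nat 2" "circuit_matrix n $$ (r0, c1) = of_nat 3"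
    "circuit_matrix n $$ (r0, c2) = of_nat 4" "circuit_matrix n $$ (r1, k) = of_nat 1"
    "circuit_matrix n $$ (r1, c1) = of_nat 2" "circuit_matrix n $$ (r1, c2) = of_nat 3"
    "circuit_matrix n $$ (k, c1) = of_nat 1" "circuit_matrix n $$ (k, c2) = of_nat 2"
    by (rule circuit_matrix_offset; use assms less off in linarith)+
  then have "minor3 (circuit_matrix n) r0 r1 k k c1 c2 = indet (Suc k)"
    using assms by (simp add: minor3_def circuit_matrix_diag algebra_simps)
  moreover have "cyclically_sorted r0 r1 k" "cyclically_sorted k c1 c2"
    using assms by (auto simp: cyclically_sorted_def defs)
  ultimately show ?thesis
    using minor3_in_minors[of r0 r1 k k c1 c2 "circuit_matrix n"] assms less by simp
qed

lemma n_minus_indet_in_minors: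
  assumes "n \<ge> 5"
  shows "of_nat n - 2 * indet 4 \<in> minors 3 (circuit_matrix n)"
proof -
  let ?A = "circuit_matrix n"
  \<comment> \<open>Row 3 reaches column 2 by wrapping around, at distance \<open>n - 1\<close>;
    this entry brings \<open>n\<close> into the minor.\<close>
  have "?A $$ (0, 2) = of_nat 2" "?A $$ (0, 3) = of_nat 3" "?A $$ (0, 4) = of_nat 4"
    "?A $$ (1, 2) = of_nat 1" "?A $$ (1, 3) = of_nat 2" "?A $$ (1, 4) = of_nat 3"
    "?A $$ (3, 2) = of_nat (n - 1)" "?A $$ (3, 4) = of_nat 1"
    by (rule circuit_matrix_offset; use assms in linarith)+
  \<comment> \<open>Matrix index 3 belongs to vertex 4, hence \<open>indet 4\<close>.\<close>
  moreover have "?A $$ (3, 3) = indet 4"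
    using assms circuit_matrix_diag[of 3 n] by simp
  ultimately have "minor3 ?A 0 1 3 2 3 4 = of_nat n - 2 * indet 4"
    using assms by (simp add: minor3_def of_nat_diff algebra_simps)
  then show ?thesis
    using minor3_in_minors_sorted[of 0 1 3 ?A 2 3 4] assms by simp
qed

theorem theorem25:
  fixes n :: nat
  assumes "n \<ge> 5"
  shows "distance_ideal 3 n (directed_circuit n)
    = Idl\<^bsub>int_mpoly_ring n\<^esub> (indet ` {1..n} \<union> {of_nat n})"
proof
  interpret R: cring "int_mpoly_ring n" by (rule int_mpoly_ring_cring)
  let ?M = "minors 3 (circuit_matrix n)" and ?S = "indet ` {1..n} \<union> {of_nat n}"
  have S: "?S \<subseteq> carrier (int_mpoly_ring n)"
    by (auto intro: int_mpoly_ring_indet[simplified] int_mpoly_ring_of_nat)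
  have M: "?M \<subseteq> carrier (int_mpoly_ring n)"
    by (rule minors_generalized_distance_matrix_carrier)
  note ideal_S = R.genideal_ideal[OF S] and ideal_M = R.genideal_ideal[OF M]
  show "distance_ideal 3 n (directed_circuit n) \<subseteq> Idl\<^bsub>int_mpoly_ring n\<^esub> ?S"
    unfolding distance_ideal_def
  \<comment> \<open>A generated ideal is the least one containing its generators, so it suffices to
    treat single minors.\<close>
  proof (rule R.genideal_minimal[OF ideal_S], rule subsetI)
    fix p assume "p \<in> ?M"
    then obtain a b c d e f where "p = minor3 (circuit_matrix n) a b c d e f"
      "a < n" "b < n" "c < n" "d < n" "e < n" "f < n"
      by (auto elim: minors_3E)
    then show "p \<in> Idl\<^bsub>int_mpoly_ring n\<^esub> ?S"
      using minor3_circuit_matrix_in_ideal[OF ideal_S] R.genideal_self[OF S] by blast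
  qed
  let ?I = "Idl\<^bsub>int_mpoly_ring n\<^esub> ?M"
  have indet: "indet i \<in> ?I" if "i \<in> {1..n}" for i
    using indet_in_minors[OF assms, of "i - 1"] that R.genideal_self[OF M] by auto
  \<comment> \<open>Twice \<open>indet 4\<close> cancels the second term of the minor
    \<open>of_nat n - 2 * indet 4\<close>.\<close>
  have "indet 4 * 2 \<in> ?I"
    using assms int_mpoly_ring_of_nat[of 2 n]
    by (intro ideal_int_mpoly_ring_mult[OF ideal_M] indet) auto
  with n_minus_indet_in_minors[OF assms] R.genideal_self[OF M]
  have "(of_nat n - 2 * indet 4) + indet 4 * 2 \<in> ?I"
    by (intro ideal_int_mpoly_ring_add[OF ideal_M]) auto
  then have "of_nat n \<in> ?I" by simp
  with indet show "Idl\<^bsub>int_mpoly_ring n\<^esub> ?S \<subseteq> distance_ideal 3 n (directed_circuit n)"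
    unfolding distance_ideal_def by (intro R.genideal_minimal[OF ideal_M]) auto
qed

end
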